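(* Let $M\ge1$ be a fixed integer and let $k$ be fixed. (1) For each $m=1,\dots,M$, $$\mathbb{P}_{\mathcal{D}_k}\big(g_T(X)\neq Y\big)-\mathbb{P}_{\mathcal{D}_k}\big(g_{mk}(X)\neq Y\big)\le \mathcal{O}_k\big(l^{-1/2}\big),$$ which implies that $$\lim_{l\to\infty}\mathbb{P}_{\mathcal{D}_k}\big(g_T(X)\neq Y\big)\le\min_{1\le m\le M}\mathbb{P}_{\mathcal{D}_k}\big(g_{mk}(X)\neq Y\big).$$ (2) Assume that for each $\nu\in\{0,1\}^M$, $$\mathbb{P}_{\mathcal{D}_k}\big((X,Y)\in A_\nu^1\big)-\mathbb{P}_{\mathcal{D}_k}\big((X,Y)\in A_\nu^0\big)\neq 0\quad\text{a.s.}$$ Then there is $K_1>0$ (not depending on $l$, but possibly depending on $k$ and $\mathcal{D}_k$) such that, for each $m=1,\dots,M$, $$\mathbb{P}_{\mathcal{D}_k}\big(g_T(X)\neq Y\big)-\mathbb{P}_{\mathcal{D}_k}\big(g_{mk}(X)\neq Y\big)\le\mathcal{O}_k\big(\exp(-K_1 l)\big).$$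
   Context: Let $\mathcal{F}$ be a separable and complete metric space and $(X,Y)$ a random pair with values in $\mathcal{F}\times\{0,1\}$. The training sample $\mathcal{D}_n=\{(X_1,Y_1),\dots,(X_n,Y_n)\}$ consists of iid copies of $(X,Y)$, and $(X,Y)$ is independent of $\mathcal{D}_n$. Write $n=k+l$ with $l\ge1$, and split the sample into $\mathcal{D}_k=\{(X_1,Y_1),\dots,(X_k,Y_k)\}$ and $\mathcal{E}_l=\{(X_{k+1},Y_{k+1}),\dots,(X_n,Y_n)\}$. Using only $\mathcal{D}_k$, one builds $M$ classifiers $g_{mk}:\mathcal{F}\to\{0,1\}$, $m=1,\dots,M$ (measurable functions of $x$ and $\mathcal{D}_k$, otherwise arbitrary), and sets $\mathbf{g_k}(x)=(g_{1k}(x),\dots,g_{Mk}(x))$. The aggregated classifier is $$g_T(x)=\mathbb{I}_{\{T_n(\mathbf{g_k}(x))>1/2\}},\qquad T_n(\mathbf{g_k}(x))=\sum_{j=k+1}^n W_{n,j}(x)Y_j,\qquad W_{n,j}(x)=\frac{\mathbb{I}_{\{\mathbf{g_k}(x)=\mathbf{g_k}(X_j)\}}}{\sum_{i=k+1}^n\mathbb{I}_{\{\mathbf{g_k}(x)=\mathbf{g_k}(X_i)\}}},\quad x\in\mathcal{F},$$ where $0/0$ is taken to be $0$. For $\nu\in\{0,1\}^M$ with $m$-th entry $\nu(m)$, define $$A_\nu^0=\Big(\bigcap_{m=1}^M g_{mk}^{-1}(\nu(m))\Big)\times\{0\},\qquad A_\nu^1=\Big(\bigcap_{m=1}^M g_{mk}^{-1}(\nu(m))\Big)\times\{1\}.$$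 $\mathbb{P}_{\mathcal{D}_k}(\cdot)=\mathbb{P}(\cdot\mid\mathcal{D}_k)$ denotes conditional probability given $\mathcal{D}_k$ (so $\mathbb{P}_{\mathcal{D}_k}(g_T(X)\neq Y)$ averages over both $(X,Y)$ and $\mathcal{E}_l$); statements about these random quantities are understood almost surely. The notation $a_l\le\mathcal{O}_k(b_l)$ means that $a_l\le A\,b_l$ for all $l\ge1$, where the finite constant $A$ may depend on $k$ and on $\mathcal{D}_k$ but not on $l$. *)

theory Defs
  imports "HOL-Probability.Probability"
begin

text \<open>Binary labels are natural numbers; the label \<sigma>-algebra is that of \<^term>\<open>count_space {0, 1::nat}\<close>,
  so measurability into it already forces the values to lie in \<^term>\<open>{0, 1::nat}\<close>.\<close>

definition obs_space :: "('f::polish_space \<times> nat) measure" where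
  "obs_space = borel \<Otimes>\<^sub>M count_space {0, 1}"

definition sample_space :: "nat \<Rightarrow> (nat \<Rightarrow> 'f::polish_space \<times> nat) measure" where
  "sample_space n = (\<Pi>\<^sub>M i\<in>{1..n}. obs_space)"

definition sample :: "(nat \<Rightarrow> 'w \<Rightarrow> 'f) \<Rightarrow> (nat \<Rightarrow> 'w \<Rightarrow> nat) \<Rightarrow> nat \<Rightarrow> 'w \<Rightarrow> (nat \<Rightarrow> 'f \<times> nat)" where
  "sample Xs Ys n \<omega> = (\<lambda>i\<in>{1..n}. (Xs i \<omega>, Ys i \<omega>))"

text \<open>\<open>g m d x\<close> is the label given to \<open>x\<close> by the \<open>m\<close>-th classifier built on the data set \<open>d\<close>.\<close>

definition classifier_vec ::
    "nat \<Rightarrow> (nat \<Rightarrow> 'd \<Rightarrow> 'f \<Rightarrow> nat) \<Rightarrow> 'd \<Rightarrow> 'f \<Rightarrow> (nat \<Rightarrow> nat)" where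
  "classifier_vec M g d x = (\<lambda>m\<in>{1..M}. g m d x)"

text \<open>The sums below run over the second part \<open>k+1, \<dots>, k+l\<close> of the sample, \<open>v\<close> stands for the
  vector of classifiers, and the convention \<open>0/0 = 0\<close> is the one of the division on \<^typ>\<open>real\<close>.\<close>

definition agg_weight ::
    "('f \<Rightarrow> nat \<Rightarrow> nat) \<Rightarrow> (nat \<Rightarrow> 'f) \<Rightarrow> nat \<Rightarrow> nat \<Rightarrow> nat \<Rightarrow> 'f \<Rightarrow> real" where
  "agg_weight v xs k l j x =
     of_bool (v x = v (xs j)) / (\<Sum>i=k+1..k+l. of_bool (v x = v (xs i)))"

definition agg_stat ::
    "('f \<Rightarrow> nat \<Rightarrow> nat) \<Rightarrow> (nat \<Rightarrow> 'f) \<Rightarrow> (nat \<Rightarrow> nat) \<Rightarrow> nat \<Rightarrow> nat \<Rightarrow> 'f \<Rightarrow> real" where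
  "agg_stat v xs ys k l x = (\<Sum>j=k+1..k+l. agg_weight v xs k l j x * real (ys j))"

definition agg_classifier ::
    "('f \<Rightarrow> nat \<Rightarrow> nat) \<Rightarrow> (nat \<Rightarrow> 'f) \<Rightarrow> (nat \<Rightarrow> nat) \<Rightarrow> nat \<Rightarrow> nat \<Rightarrow> 'f \<Rightarrow> nat" where
  "agg_classifier v xs ys k l x = of_bool (agg_stat v xs ys k l x > 1/2)"

text \<open>A version of the conditional probability of an event given the random element \<open>D\<close> with
  values in the measurable space \<open>S\<close>, i.e. given the \<sigma>-algebra generated by \<open>D\<close>.\<close>

definition cond_prob_given ::
    "'w measure \<Rightarrow> 'd measure \<Rightarrow> ('w \<Rightarrow> 'd) \<Rightarrow> ('w \<Rightarrow> bool) \<Rightarrow> 'w \<Rightarrow> real" where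
  "cond_prob_given P S D Q =
     real_cond_exp P (vimage_algebra (space P) D S) (indicator {\<omega> \<in> space P. Q \<omega>})"

definition classifier_risk ::
    "'w measure \<Rightarrow> ('w \<Rightarrow> 'f::polish_space) \<Rightarrow> ('w \<Rightarrow> nat) \<Rightarrow> (nat \<Rightarrow> 'w \<Rightarrow> 'f) \<Rightarrow> (nat \<Rightarrow> 'w \<Rightarrow> nat)
      \<Rightarrow> nat \<Rightarrow> (nat \<Rightarrow> (nat \<Rightarrow> 'f \<times> nat) \<Rightarrow> 'f \<Rightarrow> nat) \<Rightarrow> nat \<Rightarrow> 'w \<Rightarrow> real" where
  "classifier_risk P X Y Xs Ys k g m =
     cond_prob_given P (sample_space k) (sample Xs Ys k)
       (\<lambda>\<omega>. g m (sample Xs Ys k \<omega>) (X \<omega>) \<noteq> Y \<omega>)"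

definition agg_risk ::
    "'w measure \<Rightarrow> ('w \<Rightarrow> 'f::polish_space) \<Rightarrow> ('w \<Rightarrow> nat) \<Rightarrow> (nat \<Rightarrow> 'w \<Rightarrow> 'f) \<Rightarrow> (nat \<Rightarrow> 'w \<Rightarrow> nat)
      \<Rightarrow> nat \<Rightarrow> (nat \<Rightarrow> (nat \<Rightarrow> 'f \<times> nat) \<Rightarrow> 'f \<Rightarrow> nat) \<Rightarrow> nat \<Rightarrow> nat \<Rightarrow> 'w \<Rightarrow> real" where
  "agg_risk P X Y Xs Ys k g M l =
     cond_prob_given P (sample_space k) (sample Xs Ys k)
       (\<lambda>\<omega>. agg_classifier (classifier_vec M g (sample Xs Ys k \<omega>)) (\<lambda>i. Xs i \<omega>) (\<lambda>i. Ys i \<omega>) k l (X \<omega>)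
             \<noteq> Y \<omega>)"

definition cell :: "nat \<Rightarrow> (nat \<Rightarrow> 'd \<Rightarrow> 'f \<Rightarrow> nat) \<Rightarrow> 'd \<Rightarrow> (nat \<Rightarrow> nat) \<Rightarrow> nat \<Rightarrow> ('f \<times> nat) set" where
  "cell M g d \<nu> y = (\<Inter>m\<in>{1..M}. g m d -` {\<nu> m}) \<times> {y}"

text \<open>\<open>a\<^sub>l \<le> O\<^sub>k(b\<^sub>l)\<close> almost surely, where the constant is a function of the data \<open>D\<close> only;
  \<open>b\<close> itself may depend on these data.\<close>

definition bounded_by_O ::
    "'w measure \<Rightarrow> ('w \<Rightarrow> 'd) \<Rightarrow> (nat \<Rightarrow> 'w \<Rightarrow> real) \<Rightarrow> (nat \<Rightarrow> 'd \<Rightarrow> real) \<Rightarrow> bool" where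
  "bounded_by_O P D a b \<longleftrightarrow>
     (\<exists>A :: 'd \<Rightarrow> real. AE \<omega> in P. \<forall>l\<ge>1. a l \<omega> \<le> A (D \<omega>) * b l (D \<omega>))"

end

theory Submission
  imports Defs
begin

text \<open>
  Freeze the data set on which the \<open>M\<close> classifiers are built.  Since the new pair and the voting sample are
  independent of it, every conditional probability becomes an ordinary probability with that data
  set held constant (\<open>cond_prob_given_indep\<close>, \<open>cond_prob_given_sample\<close>).  The classifiers then cut the feature
  space into the finitely many cells on which their vector of values is constant.

  In a cell \<open>\<nu>\<close> let \<open>p\<^sub>0\<close> and \<open>p\<^sub>1\<close> be the probabilities that the new pair falls in the cell with label \<open>0\<close> or
  \<open>1\<close>, and let \<open>\<delta> = p\<^sub>1 - p\<^sub>0\<close>.  A rule that gives one label to the cell errs there with probability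
  \<open>min p\<^sub>0 p\<^sub>1\<close>, plus \<open>|\<delta>|\<close> if it picks the less probable label (\<open>risk_cellwise_rule\<close>).  Each single
  classifier is such a rule, so its risk is at least \<open>B\<close>, the sum of the minima over the cells.  The
  aggregated classifier is such a rule too, with a random choice of label: the sign of a sum of \<open>l\<close>
  independent ballots in \<open>{-1, 0, 1}\<close>, each with mean \<open>\<delta>\<close> (\<open>agg_classifier_eq_margin_vote\<close>,
  \<open>expectation_ballot\<close>).  By Hoeffding's inequality it picks the less probable label with probability at most
  \<open>exp (- l \<delta>\<^sup>2 / 2)\<close>.  So its risk lies between \<open>B\<close> and \<open>B\<close> plus the sum over the cells of
  \<open>|\<delta>| exp (- l \<delta>\<^sup>2 / 2)\<close> (\<open>vote_risk_bounds\<close>).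

  Each summand is at most \<open>l\<close> to the power \<open>-1/2\<close>, whatever \<open>\<delta>\<close> is (\<open>mult_exp_neg_square_le_powr\<close>), which
  gives the first rate, with the number of cells as constant, and convergence of the risk to \<open>B\<close>.  If no
  \<open>\<delta>\<close> vanishes, the smallest \<open>\<delta>\<^sup>2 / 2\<close> is positive and serves as the exponential rate.
\<close>

section \<open>Numerical and combinatorial preliminaries\<close>

lemma pred_eq_count_space:
  fixes f h :: "'x \<Rightarrow> nat"
  assumes "f \<in> N \<rightarrow>\<^sub>M count_space UNIV" "h \<in> N \<rightarrow>\<^sub>M count_space UNIV"
  shows "Measurable.pred N (\<lambda>x. f x = h x)"
proof -
  have "{x \<in> space N. real (f x) = real (h x)} \<in> sets N"
    by (intro borel_measurable_eq measurable_compose[OF assms(1)] measurable_compose[OF assms(2)]) auto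
  then show ?thesis by (simp add: pred_def)
qed

text \<open>Uniformity in \<open>x\<close> is the point: a cell with small margin \<open>x\<close> is decided wrongly with large
probability, but such a wrong decision costs only \<open>x\<close>.  With \<open>u = x \<surd>l\<close> the claim is
\<open>u exp (- u\<^sup>2/2) \<le> 1\<close>, which follows from \<open>u \<le> 1 + u\<^sup>2/2 \<le> exp (u\<^sup>2/2)\<close>.\<close>

lemma mult_exp_neg_square_le_powr:
  fixes x :: real
  assumes "x \<ge> 0" "l \<ge> 1"
  shows "x * exp (- (real l * x\<^sup>2 / 2)) \<le> real l powr (-1/2)"
proof -
  let ?u = "sqrt (real l) * x"
  have "?u \<le> 1 + ?u\<^sup>2 / 2"
    using zero_le_power2[of "?u - 1"] by (simp only: power2_diff) simp
  also have "\<dots> \<le> exp (?u\<^sup>2 / 2)"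
    by (rule exp_ge_add_one_self)
  finally have "?u * exp (- (?u\<^sup>2 / 2)) \<le> 1"
    by (simp add: exp_minus field_simps)
  then have "sqrt (real l) * (x * exp (- (real l * x\<^sup>2 / 2))) \<le> 1"
    by (simp add: power_mult_distrib mult.assoc)
  moreover have "real l powr (-1/2) = 1 / sqrt (real l)"
    by (simp add: powr_half_sqrt[symmetric] powr_minus_divide)
  ultimately show ?thesis
    using assms by (simp add: pos_le_divide_eq mult.commute)
qed

text \<open>The weighted average exceeds \<open>1/2\<close> exactly when the sum of the signs \<open>2 Y\<^sub>j - 1\<close> over the points
falling in the same cell as \<open>x\<close> is positive.  This removes the random denominator and leaves a sum of
bounded independent terms.  If no point falls in the cell, the convention \<open>0/0 = 0\<close> and the empty sum
both give label \<open>0\<close>.\<close>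

lemma agg_classifier_eq_margin_vote:
  "agg_classifier v xs ys k l x =
     of_bool ((\<Sum>j=k+1..k+l. of_bool (v (xs j) = v x) * (2 * real (ys j) - 1)) > 0)"
proof -
  let ?J = "{k+1..k+l}"
  let ?b = "\<lambda>j. of_bool (v x = v (xs j)) :: real"
  let ?N = "\<Sum>i\<in>?J. ?b i"
  have T: "agg_stat v xs ys k l x = (\<Sum>j\<in>?J. ?b j * real (ys j)) / ?N"
    by (simp only: agg_stat_def agg_weight_def sum_divide_distrib times_divide_eq_left)
  have S: "(\<Sum>j\<in>?J. of_bool (v (xs j) = v x) * (2 * real (ys j) - 1))
             = 2 * (\<Sum>j\<in>?J. ?b j * real (ys j)) - ?N"
    unfolding sum_distrib_left sum_subtractf[symmetric]
    by (intro sum.cong refl) (simp add: eq_commute[of "v x"] algebra_simps)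
  have "?N \<ge> 0"
    by (intro sum_nonneg) auto
  then consider "?N = 0" | "?N > 0"
    by linarith
  then show ?thesis
  proof cases
    case 1
    then have "\<forall>j\<in>?J. ?b j = 0"
      by (subst (asm) sum_nonneg_eq_0_iff) auto
    then have "(\<Sum>j\<in>?J. ?b j * real (ys j)) = 0"
      by (intro sum.neutral) auto
    with 1 show ?thesis
      unfolding agg_classifier_def T S by simp
  next
    case 2
    then show ?thesis
      unfolding agg_classifier_def T S by (simp add: field_simps)
  qed
qed

section \<open>Conditioning on an independent random element\<close>

text \<open>Conditioning on \<open>D\<close> amounts to freezing its value when the remaining randomness \<open>Z\<close> is independent
of it: the joint law is a product, so by Fubini the frozen probability has the integrals over
\<open>D\<close>-measurable events that characterise the conditional probability.\<close>

lemma (in prob_space) cond_prob_given_indep: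
  assumes indep: "indep_var S D T Z"
    and R: "{p \<in> space (S \<Otimes>\<^sub>M T). R (fst p) (snd p)} \<in> sets (S \<Otimes>\<^sub>M T)"
    and Q: "\<And>\<omega>. \<omega> \<in> space M \<Longrightarrow> Q \<omega> \<longleftrightarrow> R (D \<omega>) (Z \<omega>)"
  shows "AE \<omega> in M. cond_prob_given M S D Q \<omega> = prob {\<omega>' \<in> space M. R (D \<omega>) (Z \<omega>')}"
proof -
  have D[measurable]: "D \<in> M \<rightarrow>\<^sub>M S" and Z[measurable]: "Z \<in> M \<rightarrow>\<^sub>M T"
    and joint: "distr M S D \<Otimes>\<^sub>M distr M T Z = distr M (S \<Otimes>\<^sub>M T) (\<lambda>\<omega>. (D \<omega>, Z \<omega>))"
    using indep unfolding indep_var_distribution_eq by auto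
  have D_space: "D \<in> space M \<rightarrow> space S"
    using D by (auto simp: measurable_def)
  let ?F = "vimage_algebra (space M) D S"
  let ?W = "{p \<in> space (S \<Otimes>\<^sub>M T). R (fst p) (snd p)}"
  note R[measurable]
  interpret F: finite_measure_subalgebra M ?F
  proof
    show "subalgebra M ?F"
      unfolding subalgebra_def using sets_vimage_algebra2[OF D_space] by auto
  qed
  interpret DS: prob_space "distr M S D" by (rule prob_space_distr) fact
  interpret ZT: prob_space "distr M T Z" by (rule prob_space_distr) fact
  interpret DZ: pair_prob_space "distr M S D" "distr M T Z" ..
  have Q_meas[measurable]: "{\<omega> \<in> space M. Q \<omega>} \<in> events"
  proof -
    have "{\<omega> \<in> space M. Q \<omega>} = (\<lambda>\<omega>. (D \<omega>, Z \<omega>)) -` ?W \<inter> space M"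
      using Q measurable_space[OF D] measurable_space[OF Z] by (auto simp: space_pair_measure)
    then show ?thesis by (simp only:) measurable
  qed
  define h where "h s = (\<integral>t. indicator ?W (s, t) \<partial>distr M T Z :: real)" for s
  have h_meas[measurable]: "h \<in> borel_measurable S"
    unfolding h_def by (intro ZT.borel_measurable_lebesgue_integral) measurable
  have h_eq: "h (D \<omega>) = prob {\<omega>' \<in> space M. R (D \<omega>) (Z \<omega>')}" if "\<omega> \<in> space M" for \<omega>
  proof -
    have s: "D \<omega> \<in> space S" using that D_space by auto
    have "h (D \<omega>) = (\<integral>\<omega>'. indicator ?W (D \<omega>, Z \<omega>') \<partial>M)"
      unfolding h_def using s by (intro integral_distr) measurable
    also have "\<dots> = (\<integral>\<omega>'. indicator {\<omega>' \<in> space M. R (D \<omega>) (Z \<omega>')} \<omega>' \<partial>M)"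
      using s measurable_space[OF Z]
      by (intro Bochner_Integration.integral_cong) (auto simp: space_pair_measure split: split_indicator)
    finally show ?thesis by (simp add: Int_def conj_commute)
  qed
  have "AE \<omega> in M. real_cond_exp M ?F (indicator {\<omega> \<in> space M. Q \<omega>}) \<omega> = h (D \<omega>)"
  proof (rule F.real_cond_exp_charact)
    fix A assume "A \<in> sets ?F"
    then obtain B where B[measurable]: "B \<in> sets S" and A: "A = D -` B \<inter> space M"
      using sets_vimage_algebra2[OF D_space] by auto
    have "(\<integral>\<omega>\<in>A. (indicator {\<omega> \<in> space M. Q \<omega>} \<omega> :: real) \<partial>M)
          = (\<integral>\<omega>. indicator B (D \<omega>) * indicator ?W (D \<omega>, Z \<omega>) \<partial>M)"
      unfolding set_lebesgue_integral_def using Q measurable_space[OF D] measurable_space[OF Z]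
      by (intro Bochner_Integration.integral_cong)
        (auto simp: A space_pair_measure split: split_indicator)
    also have "\<dots> = (\<integral>p. indicator B (fst p) * indicator ?W p \<partial>distr M (S \<Otimes>\<^sub>M T) (\<lambda>\<omega>. (D \<omega>, Z \<omega>)))"
      by (subst integral_distr) auto
    also have "\<dots> = (\<integral>p. indicator B (fst p) * indicator ?W p \<partial>(distr M S D \<Otimes>\<^sub>M distr M T Z))"
      by (simp add: joint)
    also have "\<dots> = (\<integral>s. \<integral>t. indicator B s * indicator ?W (s, t) \<partial>distr M T Z \<partial>distr M S D)"
      by (subst DZ.integral_fst'[symmetric])
        (auto intro!: DZ.integrable_const_bound[where B=1] simp: split_indicator_asm split: split_indicator)
    also have "\<dots> = (\<integral>s. indicator B s * h s \<partial>distr M S D)"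
      by (simp add: h_def)
    also have "\<dots> = (\<integral>\<omega>. indicator B (D \<omega>) * h (D \<omega>) \<partial>M)"
      by (subst integral_distr) auto
    also have "\<dots> = (\<integral>\<omega>\<in>A. h (D \<omega>) \<partial>M)"
      unfolding set_lebesgue_integral_def
      by (intro Bochner_Integration.integral_cong) (auto simp: A split: split_indicator)
    finally show "(\<integral>\<omega>\<in>A. (indicator {\<omega> \<in> space M. Q \<omega>} \<omega> :: real) \<partial>M) = (\<integral>\<omega>\<in>A. h (D \<omega>) \<partial>M)" .
  next
    show "integrable M (indicator {\<omega> \<in> space M. Q \<omega>} :: _ \<Rightarrow> real)"
      by (simp add: emeasure_eq_measure)
    have "h (D \<omega>) \<le> 1 \<and> 0 \<le> h (D \<omega>)" if "\<omega> \<in> space M" for \<omega>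
      using h_eq[OF that] by simp
    then show "integrable M (\<lambda>\<omega>. h (D \<omega>))"
      by (intro integrable_const_bound[where B=1]) auto
    show "(\<lambda>\<omega>. h (D \<omega>)) \<in> borel_measurable ?F"
      by (rule measurable_compose[OF measurable_vimage_algebra1[OF D_space] h_meas])
  qed
  then show ?thesis
    using h_eq by (auto simp: cond_prob_given_def)
qed

section \<open>The new observation and the sample\<close>

locale iid_sample = prob_space P for P :: "'w measure" +
  fixes X :: "'w \<Rightarrow> 'f::polish_space" and Y :: "'w \<Rightarrow> nat"
    and Xs :: "nat \<Rightarrow> 'w \<Rightarrow> 'f" and Ys :: "nat \<Rightarrow> 'w \<Rightarrow> nat"
  assumes XY: "(\<lambda>\<omega>. (X \<omega>, Y \<omega>)) \<in> P \<rightarrow>\<^sub>M obs_space"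
    and indep: "indep_vars (\<lambda>_. obs_space) (\<lambda>i \<omega>. (Xs i \<omega>, Ys i \<omega>)) {1..}"
    and ident: "\<And>i. i \<ge> 1 \<Longrightarrow>
      distr P obs_space (\<lambda>\<omega>. (Xs i \<omega>, Ys i \<omega>)) = distr P obs_space (\<lambda>\<omega>. (X \<omega>, Y \<omega>))"
    and indep_sample: "\<And>n. indep_set
      (sets (vimage_algebra (space P) (\<lambda>\<omega>. (X \<omega>, Y \<omega>)) obs_space))
      (sets (vimage_algebra (space P) (sample Xs Ys n) (sample_space n)))"
begin

text \<open>The new observation takes index \<open>0\<close> in front of the sample, so that it can be treated as one more
member of a single independent family.\<close>

definition obs :: "nat \<Rightarrow> 'w \<Rightarrow> 'f \<times> nat" where
  "obs i \<omega> = (if i = 0 then (X \<omega>, Y \<omega>) else (Xs i \<omega>, Ys i \<omega>))"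

lemma measurable_sample_obs: "i \<ge> 1 \<Longrightarrow> (\<lambda>\<omega>. (Xs i \<omega>, Ys i \<omega>)) \<in> P \<rightarrow>\<^sub>M obs_space"
  using indep unfolding indep_vars_def by auto

lemma measurable_obs [measurable]: "obs i \<in> P \<rightarrow>\<^sub>M obs_space"
  using XY measurable_sample_obs[of i] by (cases "i = 0") (simp_all add: obs_def[abs_def])

lemma measurable_label: "(\<lambda>p. snd p) \<in> obs_space \<rightarrow>\<^sub>M count_space UNIV"
  unfolding obs_space_def by (rule measurable_compose[OF measurable_snd]) simp

lemma measurable_point: "(\<lambda>p. fst p) \<in> obs_space \<rightarrow>\<^sub>M borel"
  unfolding obs_space_def by (rule measurable_fst)

lemma measurable_X [measurable]: "X \<in> P \<rightarrow>\<^sub>M borel"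
  using measurable_compose[OF XY measurable_point] by simp

lemma measurable_Y [measurable]: "Y \<in> P \<rightarrow>\<^sub>M count_space UNIV"
  using measurable_compose[OF XY measurable_label] by simp

lemma label_cases: "\<omega> \<in> space P \<Longrightarrow> Y \<omega> = 0 \<or> Y \<omega> = 1"
  using measurable_space[OF XY] by (auto simp: obs_space_def space_pair_measure)

lemma sample_label_cases: "i \<ge> 1 \<Longrightarrow> \<omega> \<in> space P \<Longrightarrow> Ys i \<omega> = 0 \<or> Ys i \<omega> = 1"
  using measurable_space[OF measurable_sample_obs] by (fastforce simp: obs_space_def space_pair_measure)

lemma sample_eq_obs: "sample Xs Ys n = (\<lambda>\<omega>. \<lambda>i\<in>{1..n}. obs i \<omega>)"
  by (auto simp: sample_def obs_def fun_eq_iff)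

lemma measurable_sample [measurable]: "sample Xs Ys n \<in> P \<rightarrow>\<^sub>M sample_space n"
  unfolding sample_space_def sample_eq_obs by measurable

lemma prob_new_and_sample:
  assumes "A \<in> sets obs_space" "B \<in> sets (sample_space n)"
  shows "prob ((\<lambda>\<omega>. (X \<omega>, Y \<omega>)) -` A \<inter> space P \<inter> (sample Xs Ys n -` B \<inter> space P))
       = prob ((\<lambda>\<omega>. (X \<omega>, Y \<omega>)) -` A \<inter> space P) * prob (sample Xs Ys n -` B \<inter> space P)"
  using assms by (intro indep_setD[OF indep_sample[of n]] in_vimage_algebra)

text \<open>Independence of the new pair from the whole sample factors off coordinate \<open>0\<close> of a cylinder event;
independence within the sample factors the rest.\<close>

lemma indep_vars_obs:
  assumes "n \<ge> 1"
  shows "indep_vars (\<lambda>_. obs_space) obs {0..n}"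
proof (subst indep_vars_finite[where E = "\<lambda>_. sets obs_space"])
  show "\<forall>A\<in>(\<Pi> i\<in>{0..n}. sets obs_space). prob (\<Inter>j\<in>{0..n}. obs j -` A j \<inter> space P) =
      (\<Prod>j\<in>{0..n}. prob (obs j -` A j \<inter> space P))"
  proof
    fix A :: "nat \<Rightarrow> ('f \<times> nat) set" assume "A \<in> (\<Pi> i\<in>{0..n}. sets obs_space)"
    then have A: "A j \<in> sets obs_space" if "j \<le> n" for j
      using that by auto
    let ?B = "PiE {1..n} A"
    have B: "?B \<in> sets (sample_space n)"
      unfolding sample_space_def using A by (intro sets_PiM_I_finite) auto
    have ins: "{0..n} = insert 0 {1..n}"
      by auto
    have smp: "(\<Inter>j\<in>{1..n}. obs j -` A j \<inter> space P) = sample Xs Ys n -` ?B \<inter> space P"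
      using assms by (auto simp: sample_eq_obs PiE_iff)
    have "indep_vars (\<lambda>_. obs_space) obs {1..n}"
      by (subst indep_vars_cong[OF refl, of _ _ "\<lambda>i \<omega>. (Xs i \<omega>, Ys i \<omega>)"])
        (auto simp: obs_def fun_eq_iff intro: indep_vars_subset[OF indep])
    then have "prob (\<Inter>j\<in>{1..n}. obs j -` A j \<inter> space P) = (\<Prod>j\<in>{1..n}. prob (obs j -` A j \<inter> space P))"
      by (rule indep_varsD_finite) (use assms A in auto)
    moreover have "(\<Inter>j\<in>{0..n}. obs j -` A j \<inter> space P)
        = (\<lambda>\<omega>. (X \<omega>, Y \<omega>)) -` A 0 \<inter> space P \<inter> (sample Xs Ys n -` ?B \<inter> space P)"
      unfolding ins by (simp only: INT_insert smp) (simp add: obs_def[abs_def])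
    moreover have "obs 0 -` A 0 \<inter> space P = (\<lambda>\<omega>. (X \<omega>, Y \<omega>)) -` A 0 \<inter> space P"
      by (simp add: obs_def[abs_def])
    ultimately show "prob (\<Inter>j\<in>{0..n}. obs j -` A j \<inter> space P) =
        (\<Prod>j\<in>{0..n}. prob (obs j -` A j \<inter> space P))"
      using prob_new_and_sample[OF A[of 0] B] unfolding ins smp by (simp del: One_nat_def)
  qed
qed (auto simp: sets.sigma_sets_eq sets.Int_stable sets.sets_into_space dest: sets.sets_into_space)

text \<open>The first \<open>k\<close> observations are independent of the block consisting of the new observation and the
voting sample, so the risks given the data are ordinary probabilities with the data frozen.\<close>

lemma cond_prob_given_sample:
  assumes "l \<ge> 1"
    and R: "{p \<in> space (sample_space k \<Otimes>\<^sub>M (\<Pi>\<^sub>M i\<in>insert 0 {k+1..k+l}. obs_space)). R (fst p) (snd p)}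
        \<in> sets (sample_space k \<Otimes>\<^sub>M (\<Pi>\<^sub>M i\<in>insert 0 {k+1..k+l}. obs_space))"
    and Q: "\<And>d \<omega>. \<omega> \<in> space P \<Longrightarrow> Q d \<omega> \<longleftrightarrow> R d (\<lambda>i\<in>insert 0 {k+1..k+l}. obs i \<omega>)"
  shows "AE \<omega> in P. cond_prob_given P (sample_space k) (sample Xs Ys k)
             (\<lambda>\<omega>. Q (sample Xs Ys k \<omega>) \<omega>) \<omega>
           = prob {\<omega>' \<in> space P. Q (sample Xs Ys k \<omega>) \<omega>'}"
proof -
  have "indep_var (sample_space k) (sample Xs Ys k)
      (\<Pi>\<^sub>M i\<in>insert 0 {k+1..k+l}. obs_space) (\<lambda>\<omega>. \<lambda>i\<in>insert 0 {k+1..k+l}. obs i \<omega>)"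
    unfolding sample_space_def sample_eq_obs
    using assms(1) by (intro indep_var_restrict[OF indep_vars_obs[of "k+l"]]) auto
  from cond_prob_given_indep[OF this R, of "\<lambda>\<omega>. Q (sample Xs Ys k \<omega>) \<omega>"]
  have "AE \<omega> in P. cond_prob_given P (sample_space k) (sample Xs Ys k)
             (\<lambda>\<omega>. Q (sample Xs Ys k \<omega>) \<omega>) \<omega>
           = prob {\<omega>' \<in> space P. R (sample Xs Ys k \<omega>) (\<lambda>i\<in>insert 0 {k+1..k+l}. obs i \<omega>')}"
    using Q by blast
  moreover have "{\<omega>' \<in> space P. Q d \<omega>'} = {\<omega>' \<in> space P. R d (\<lambda>i\<in>insert 0 {k+1..k+l}. obs i \<omega>')}" for d
    using Q by blast
  ultimately show ?thesis by simp
qed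

end

section \<open>Votes in the cells of a fixed partition\<close>

text \<open>Once the data are frozen, the classifiers matter only through the finite partition of the feature
space by their vector of values; \<open>c\<close> maps a point to the label of its cell.\<close>

locale partitioned_sample = iid_sample P X Y Xs Ys
  for P :: "'w measure" and X :: "'w \<Rightarrow> 'f::polish_space" and Y and Xs :: "nat \<Rightarrow> 'w \<Rightarrow> 'f" and Ys +
  fixes c :: "'f \<Rightarrow> 'c" and F :: "'c set"
  assumes finite_cells: "finite F"
    and cell_in: "\<And>x. c x \<in> F"
    and measurable_cell: "\<And>\<nu>. \<nu> \<in> F \<Longrightarrow> {x. c x = \<nu>} \<in> sets borel"
begin

definition cell_prob :: "'c \<Rightarrow> nat \<Rightarrow> real" where
  "cell_prob \<nu> y = prob {\<omega> \<in> space P. c (X \<omega>) = \<nu> \<and> Y \<omega> = y}"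

text \<open>The margin is the additional risk incurred in a cell by choosing the less probable label instead of the more
probable one, signed so that it is positive when label \<open>1\<close> is the better choice.\<close>

definition margin :: "'c \<Rightarrow> real" where
  "margin \<nu> = cell_prob \<nu> 1 - cell_prob \<nu> 0"

text \<open>An observation in the cell votes \<open>+1\<close> or \<open>-1\<close> according to its label and an observation elsewhere
abstains.  Abstentions keep the number of summands deterministic.\<close>

definition ballot :: "'c \<Rightarrow> 'f \<times> nat \<Rightarrow> real" where
  "ballot \<nu> p = of_bool (c (fst p) = \<nu>) * (2 * real (snd p) - 1)"

definition vote :: "nat set \<Rightarrow> 'c \<Rightarrow> 'w \<Rightarrow> real" where
  "vote J \<nu> \<omega> = (\<Sum>j\<in>J. ballot \<nu> (Xs j \<omega>, Ys j \<omega>))"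

text \<open>No rule that is constant on cells can have a smaller risk.\<close>

definition best_cell_risk :: real where
  "best_cell_risk = (\<Sum>\<nu>\<in>F. min (cell_prob \<nu> 0) (cell_prob \<nu> 1))"

lemma measurable_in_cell [measurable]: "Measurable.pred borel (\<lambda>x. c x = \<nu>)"
proof (cases "\<nu> \<in> F")
  case True
  then show ?thesis using measurable_cell by (simp add: pred_def)
next
  case False
  then have "(\<lambda>x. c x = \<nu>) = (\<lambda>_. False)" using cell_in by auto
  then show ?thesis by simp
qed

lemma measurable_ballot [measurable]: "ballot \<nu> \<in> borel_measurable obs_space"
proof -
  note [measurable] = measurable_point measurable_label
  show ?thesis unfolding ballot_def[abs_def] by measurable
qed

lemma ballot_bounded: "\<omega> \<in> space P \<Longrightarrow> j \<ge> 1 \<Longrightarrow> ballot \<nu> (Xs j \<omega>, Ys j \<omega>) \<in> {-1..1}"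
  using sample_label_cases[of j \<omega>] by (auto simp: ballot_def)

text \<open>The mean of a ballot is the margin: the vote estimates, without bias, precisely the quantity whose
sign determines the best label of the cell.\<close>

lemma expectation_ballot:
  assumes "j \<ge> 1"
  shows "expectation (\<lambda>\<omega>. ballot \<nu> (Xs j \<omega>, Ys j \<omega>)) = margin \<nu>"
proof -
  have "expectation (\<lambda>\<omega>. ballot \<nu> (Xs j \<omega>, Ys j \<omega>))
      = integral\<^sup>L (distr P obs_space (\<lambda>\<omega>. (Xs j \<omega>, Ys j \<omega>))) (ballot \<nu>)"
    by (intro integral_distr[symmetric] measurable_ballot measurable_sample_obs assms)
  also have "\<dots> = integral\<^sup>L (distr P obs_space (\<lambda>\<omega>. (X \<omega>, Y \<omega>))) (ballot \<nu>)"
    by (simp only: ident[OF assms])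
  also have "\<dots> = expectation (\<lambda>\<omega>. ballot \<nu> (X \<omega>, Y \<omega>))"
    by (intro integral_distr measurable_ballot XY)
  also have "\<dots> = expectation (\<lambda>\<omega>. indicator {\<omega> \<in> space P. c (X \<omega>) = \<nu> \<and> Y \<omega> = 1} \<omega>
      - indicator {\<omega> \<in> space P. c (X \<omega>) = \<nu> \<and> Y \<omega> = 0} \<omega>)"
  proof (intro Bochner_Integration.integral_cong refl)
    fix \<omega> assume "\<omega> \<in> space P"
    with label_cases[of \<omega>]
    show "ballot \<nu> (X \<omega>, Y \<omega>) = indicator {\<omega> \<in> space P. c (X \<omega>) = \<nu> \<and> Y \<omega> = 1} \<omega>
      - indicator {\<omega> \<in> space P. c (X \<omega>) = \<nu> \<and> Y \<omega> = 0} \<omega>"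
      by (auto simp: ballot_def)
  qed
  also have "\<dots> = expectation (indicator {\<omega> \<in> space P. c (X \<omega>) = \<nu> \<and> Y \<omega> = 1})
      - expectation (indicator {\<omega> \<in> space P. c (X \<omega>) = \<nu> \<and> Y \<omega> = 0})"
    by (intro Bochner_Integration.integral_diff) (auto simp: emeasure_eq_measure)
  also have "\<dots> = margin \<nu>"
    by (simp add: margin_def cell_prob_def Int_def conj_commute conj_left_commute)
  finally show ?thesis .
qed

lemma measurable_vote [measurable]:
  assumes "J \<subseteq> {1..}"
  shows "vote J \<nu> \<in> borel_measurable P"
  unfolding vote_def[abs_def] using assms
  by (intro borel_measurable_sum measurable_compose[OF measurable_sample_obs measurable_ballot]) auto

text \<open>A wrong decision means that the sum of the ballots deviates from its mean by at least the absolute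
value of that mean, \<open>|J| |margin|\<close>; Hoeffding's inequality for ballots in \<open>[-1, 1]\<close> gives the
bound.  A tie elects label \<open>0\<close>, whence the asymmetry between the two events.\<close>

lemma prob_wrong_vote_le:
  assumes J: "finite J" "J \<noteq> {}" "J \<subseteq> {1..}"
  shows "margin \<nu> \<ge> 0 \<Longrightarrow> prob {\<omega> \<in> space P. vote J \<nu> \<omega> \<le> 0} \<le> exp (- (real (card J) * (margin \<nu>)\<^sup>2 / 2))"
    and "margin \<nu> < 0 \<Longrightarrow> prob {\<omega> \<in> space P. vote J \<nu> \<omega> > 0} \<le> exp (- (real (card J) * (margin \<nu>)\<^sup>2 / 2))"
proof -
  let ?l = "real (card J)"
  have l: "?l > 0" using J by (simp add: card_gt_0_iff)
  interpret H: Hoeffding_ineq P J "\<lambda>j \<omega>. ballot \<nu> (Xs j \<omega>, Ys j \<omega>)" "\<lambda>_. -1" "\<lambda>_. 1" "?l * margin \<nu>"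
  proof unfold_locales
    show "indep_vars (\<lambda>_. borel) (\<lambda>j \<omega>. ballot \<nu> (Xs j \<omega>, Ys j \<omega>)) J"
      by (rule indep_vars_compose2[OF indep_vars_subset[OF indep J(3)]]) simp
    show "AE \<omega> in P. ballot \<nu> (Xs j \<omega>, Ys j \<omega>) \<in> {- 1..1}" if "j \<in> J" for j
      using ballot_bounded[of _ j] that J(3) by (intro AE_I2) auto
    have "(\<Sum>j\<in>J. expectation (\<lambda>\<omega>. ballot \<nu> (Xs j \<omega>, Ys j \<omega>))) = (\<Sum>j\<in>J. margin \<nu>)"
      using J(3) by (intro sum.cong expectation_ballot) auto
    then show "?l * margin \<nu> \<equiv> \<Sum>j\<in>J. expectation (\<lambda>\<omega>. ballot \<nu> (Xs j \<omega>, Ys j \<omega>))"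
      by simp
  qed (fact J)
  have width: "(\<Sum>j\<in>J. (1 - (-1::real))\<^sup>2) = 4 * ?l"
    by simp
  have expo: "-2 * (?l * x)\<^sup>2 / (4 * ?l) = - (?l * x\<^sup>2 / 2)" for x :: real
    using l by (simp add: power2_eq_square field_simps)
  show "prob {\<omega> \<in> space P. vote J \<nu> \<omega> \<le> 0} \<le> exp (- (?l * (margin \<nu>)\<^sup>2 / 2))" if "margin \<nu> \<ge> 0"
  proof -
    have "?l * margin \<nu> \<ge> 0" using that by simp
    from H.Hoeffding_ineq_le[OF this] l show ?thesis
      unfolding width expo by (simp add: vote_def)
  qed
  show "prob {\<omega> \<in> space P. vote J \<nu> \<omega> > 0} \<le> exp (- (?l * (margin \<nu>)\<^sup>2 / 2))" if "margin \<nu> < 0"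
  proof -
    have "prob {\<omega> \<in> space P. vote J \<nu> \<omega> > 0} \<le> prob {\<omega> \<in> space P. vote J \<nu> \<omega> \<ge> 0}"
      using J(3) by (intro finite_measure_mono) auto
    moreover have "?l * (- margin \<nu>) \<ge> 0" using that by (intro mult_nonneg_nonneg) auto
    from H.Hoeffding_ineq_ge[OF this] l
    have "prob {\<omega> \<in> space P. vote J \<nu> \<omega> \<ge> 0} \<le> exp (- (?l * (margin \<nu>)\<^sup>2 / 2))"
      unfolding width expo by (simp add: vote_def)
    ultimately show ?thesis by simp
  qed
qed

text \<open>The vote is a function of the sample alone, of which the new observation is independent.\<close>

lemma prob_cell_and_vote:
  assumes J: "J \<subseteq> {1..n}"
  shows "prob {\<omega> \<in> space P. c (X \<omega>) = \<nu> \<and> Y \<omega> = y \<and> vote J \<nu> \<omega> > 0}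
       = cell_prob \<nu> y * prob {\<omega> \<in> space P. vote J \<nu> \<omega> > 0}"
proof -
  note [measurable] = measurable_point measurable_label
  define A where "A = {p \<in> space obs_space. c (fst p) = \<nu> \<and> snd p = y}"
  define B where "B = {s \<in> space (sample_space n). (\<Sum>j\<in>J. ballot \<nu> (s j)) > 0}"
  have A: "A \<in> sets obs_space"
    unfolding A_def by measurable
  have "(\<lambda>s. s j) \<in> sample_space n \<rightarrow>\<^sub>M obs_space" if "j \<in> J" for j
    unfolding sample_space_def using that J by (intro measurable_component_singleton) auto
  then have "(\<lambda>s. \<Sum>j\<in>J. ballot \<nu> (s j)) \<in> borel_measurable (sample_space n)"
    by (intro borel_measurable_sum measurable_compose[OF _ measurable_ballot])
  then have B: "B \<in> sets (sample_space n)"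
    unfolding B_def by measurable
  have smp: "(\<Sum>j\<in>J. ballot \<nu> (sample Xs Ys n \<omega> j)) = vote J \<nu> \<omega>" for \<omega>
    unfolding vote_def using J by (intro sum.cong) (auto simp: sample_def)
  have a: "(\<lambda>\<omega>. (X \<omega>, Y \<omega>)) -` A \<inter> space P = {\<omega> \<in> space P. c (X \<omega>) = \<nu> \<and> Y \<omega> = y}"
    using measurable_space[OF XY] by (auto simp: A_def)
  have b: "sample Xs Ys n -` B \<inter> space P = {\<omega> \<in> space P. vote J \<nu> \<omega> > 0}"
    using measurable_space[OF measurable_sample[of n]] by (auto simp: B_def smp)
  have "{\<omega> \<in> space P. c (X \<omega>) = \<nu> \<and> Y \<omega> = y \<and> vote J \<nu> \<omega> > 0}
      = (\<lambda>\<omega>. (X \<omega>, Y \<omega>)) -` A \<inter> space P \<inter> (sample Xs Ys n -` B \<inter> space P)"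
    unfolding a b by auto
  then show ?thesis
    using prob_new_and_sample[OF A B] unfolding a b cell_prob_def by simp
qed

text \<open>Let \<open>r \<nu>\<close> say that the rule assigns label \<open>1\<close> to cell \<open>\<nu>\<close>; this may be random, but must be independent
of the new observation falling in the cell with a given label.  In each cell the better label is unavoidably wrong with the smaller of the
two cell probabilities, and the absolute margin is paid in addition exactly when the other label is
chosen.  A single classifier (\<open>r\<close> deterministic) and the vote are both instances.\<close>

lemma risk_cellwise_rule:
  assumes ev: "\<And>\<nu>. \<nu> \<in> F \<Longrightarrow> {\<omega> \<in> space P. r \<nu> \<omega>} \<in> events"
    and ind: "\<And>\<nu> y. \<nu> \<in> F \<Longrightarrow> prob {\<omega> \<in> space P. c (X \<omega>) = \<nu> \<and> Y \<omega> = y \<and> r \<nu> \<omega>}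
        = cell_prob \<nu> y * prob {\<omega> \<in> space P. r \<nu> \<omega>}"
  shows "prob {\<omega> \<in> space P. of_bool (r (c (X \<omega>)) \<omega>) \<noteq> Y \<omega>}
       = best_cell_risk + (\<Sum>\<nu>\<in>F. \<bar>margin \<nu>\<bar> *
           prob {\<omega> \<in> space P. if margin \<nu> \<ge> 0 then \<not> r \<nu> \<omega> else r \<nu> \<omega>})"
proof -
  let ?E = "\<lambda>\<nu>. {\<omega> \<in> space P. c (X \<omega>) = \<nu> \<and> Y \<omega> = 0 \<and> r \<nu> \<omega>}"
  let ?G = "\<lambda>\<nu>. {\<omega> \<in> space P. c (X \<omega>) = \<nu> \<and> Y \<omega> = 1} - {\<omega> \<in> space P. c (X \<omega>) = \<nu> \<and> Y \<omega> = 1 \<and> r \<nu> \<omega>}"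
  let ?q = "\<lambda>\<nu>. prob {\<omega> \<in> space P. r \<nu> \<omega>}"
  have cell_ev: "{\<omega> \<in> space P. c (X \<omega>) = \<nu> \<and> Y \<omega> = y} \<in> events" for \<nu> y
    by measurable
  have joint_ev: "{\<omega> \<in> space P. c (X \<omega>) = \<nu> \<and> Y \<omega> = y \<and> r \<nu> \<omega>} \<in> events" if "\<nu> \<in> F" for \<nu> y
  proof -
    have "{\<omega> \<in> space P. c (X \<omega>) = \<nu> \<and> Y \<omega> = y \<and> r \<nu> \<omega>}
        = {\<omega> \<in> space P. c (X \<omega>) = \<nu> \<and> Y \<omega> = y} \<inter> {\<omega> \<in> space P. r \<nu> \<omega>}"
      by auto
    then show ?thesis using cell_ev ev[OF that] by simp
  qed
  have union: "{\<omega> \<in> space P. of_bool (r (c (X \<omega>)) \<omega>) \<noteq> Y \<omega>} = (\<Union>\<nu>\<in>F. ?E \<nu> \<union> ?G \<nu>)"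
  proof -
    have "of_bool (r (c (X \<omega>)) \<omega>) \<noteq> Y \<omega> \<longleftrightarrow> Y \<omega> = 0 \<and> r (c (X \<omega>)) \<omega> \<or> Y \<omega> = 1 \<and> \<not> r (c (X \<omega>)) \<omega>"
      if "\<omega> \<in> space P" for \<omega>
      using label_cases[OF that] by (cases "r (c (X \<omega>)) \<omega>") auto
    then have "{\<omega> \<in> space P. of_bool (r (c (X \<omega>)) \<omega>) \<noteq> Y \<omega>}
        = {\<omega> \<in> space P. Y \<omega> = 0 \<and> r (c (X \<omega>)) \<omega> \<or> Y \<omega> = 1 \<and> \<not> r (c (X \<omega>)) \<omega>}"
      by (intro Collect_cong) blast
    also have "\<dots> = (\<Union>\<nu>\<in>F. ?E \<nu> \<union> ?G \<nu>)"
      using cell_in by auto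
    finally show ?thesis .
  qed
  have complement: "prob {\<omega> \<in> space P. \<not> r \<nu> \<omega>} = 1 - ?q \<nu>" if "\<nu> \<in> F" for \<nu>
    by (rule prob_neg) (rule ev[OF that])
  have "prob {\<omega> \<in> space P. of_bool (r (c (X \<omega>)) \<omega>) \<noteq> Y \<omega>} = (\<Sum>\<nu>\<in>F. prob (?E \<nu> \<union> ?G \<nu>))"
    unfolding union using joint_ev cell_ev
    by (intro finite_measure_finite_Union finite_cells) (auto simp: disjoint_family_on_def)
  also have "\<dots> = (\<Sum>\<nu>\<in>F. cell_prob \<nu> 0 * ?q \<nu> + cell_prob \<nu> 1 * (1 - ?q \<nu>))"
  proof (intro sum.cong refl)
    fix \<nu> assume \<nu>: "\<nu> \<in> F"
    have "prob (?E \<nu> \<union> ?G \<nu>) = prob (?E \<nu>) + prob (?G \<nu>)"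
      using joint_ev[OF \<nu>] cell_ev by (intro finite_measure_Union) auto
    also have "prob (?G \<nu>) = cell_prob \<nu> 1 - cell_prob \<nu> 1 * ?q \<nu>"
      using joint_ev[OF \<nu>] cell_ev ind[OF \<nu>, of 1]
      by (subst finite_measure_Diff) (auto simp: cell_prob_def)
    finally show "prob (?E \<nu> \<union> ?G \<nu>) = cell_prob \<nu> 0 * ?q \<nu> + cell_prob \<nu> 1 * (1 - ?q \<nu>)"
      using ind[OF \<nu>, of 0] by (simp add: algebra_simps)
  qed
  also have "\<dots> = (\<Sum>\<nu>\<in>F. min (cell_prob \<nu> 0) (cell_prob \<nu> 1) + \<bar>margin \<nu>\<bar> *
           prob {\<omega> \<in> space P. if margin \<nu> \<ge> 0 then \<not> r \<nu> \<omega> else r \<nu> \<omega>})"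
  proof (intro sum.cong refl)
    fix \<nu> assume \<nu>: "\<nu> \<in> F"
    show "cell_prob \<nu> 0 * ?q \<nu> + cell_prob \<nu> 1 * (1 - ?q \<nu>)
        = min (cell_prob \<nu> 0) (cell_prob \<nu> 1) + \<bar>margin \<nu>\<bar> *
           prob {\<omega> \<in> space P. if margin \<nu> \<ge> 0 then \<not> r \<nu> \<omega> else r \<nu> \<omega>}"
    proof (cases "margin \<nu> \<ge> 0")
      case True
      then have "min (cell_prob \<nu> 0) (cell_prob \<nu> 1) = cell_prob \<nu> 0"
        by (simp add: margin_def)
      with True show ?thesis
        by (simp add: complement[OF \<nu>]) (simp add: margin_def algebra_simps)
    next
      case False
      then have "min (cell_prob \<nu> 0) (cell_prob \<nu> 1) = cell_prob \<nu> 1"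
        by (simp add: margin_def)
      with False show ?thesis
        by simp (simp add: margin_def algebra_simps)
    qed
  qed
  finally show ?thesis
    by (simp add: best_cell_risk_def sum.distrib)
qed

lemma best_cell_risk_le:
  "best_cell_risk \<le> prob {\<omega> \<in> space P. of_bool (r (c (X \<omega>))) \<noteq> Y \<omega>}"
proof -
  have "prob {\<omega> \<in> space P. of_bool (r (c (X \<omega>))) \<noteq> Y \<omega>}
      = best_cell_risk + (\<Sum>\<nu>\<in>F. \<bar>margin \<nu>\<bar> *
           prob {\<omega> \<in> space P. if margin \<nu> \<ge> 0 then \<not> r \<nu> else r \<nu>})"
    by (rule risk_cellwise_rule[of "\<lambda>\<nu> _. r \<nu>"]) (simp, case_tac "r \<nu>", simp_all add: cell_prob_def prob_space)
  then show ?thesis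
    by (simp add: sum_nonneg)
qed

text \<open>The price of a wrong decision (the margin) times its probability (Hoeffding), summed over the cells.\<close>

lemma vote_risk_bounds:
  assumes J: "finite J" "J \<noteq> {}" "J \<subseteq> {1..}"
  shows "best_cell_risk \<le> prob {\<omega> \<in> space P. of_bool (vote J (c (X \<omega>)) \<omega> > 0) \<noteq> Y \<omega>}"
    and "prob {\<omega> \<in> space P. of_bool (vote J (c (X \<omega>)) \<omega> > 0) \<noteq> Y \<omega>}
      \<le> best_cell_risk + (\<Sum>\<nu>\<in>F. \<bar>margin \<nu>\<bar> * exp (- (real (card J) * (margin \<nu>)\<^sup>2 / 2)))"
proof -
  let ?w = "\<lambda>\<nu>. prob {\<omega> \<in> space P. if margin \<nu> \<ge> 0 then \<not> vote J \<nu> \<omega> > 0 else vote J \<nu> \<omega> > 0}"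
  have "J \<subseteq> {1..Max J}"
    using J by auto
  then have risk: "prob {\<omega> \<in> space P. of_bool (vote J (c (X \<omega>)) \<omega> > 0) \<noteq> Y \<omega>}
      = best_cell_risk + (\<Sum>\<nu>\<in>F. \<bar>margin \<nu>\<bar> * ?w \<nu>)"
    using J(3) by (intro risk_cellwise_rule[of "\<lambda>\<nu> \<omega>. vote J \<nu> \<omega> > 0"] prob_cell_and_vote) auto
  show "best_cell_risk \<le> prob {\<omega> \<in> space P. of_bool (vote J (c (X \<omega>)) \<omega> > 0) \<noteq> Y \<omega>}"
    unfolding risk by (simp add: sum_nonneg)
  have "?w \<nu> \<le> exp (- (real (card J) * (margin \<nu>)\<^sup>2 / 2))" for \<nu>
    using prob_wrong_vote_le[OF J, of \<nu>] by (cases "margin \<nu> \<ge> 0") (simp_all add: not_less)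
  then show "prob {\<omega> \<in> space P. of_bool (vote J (c (X \<omega>)) \<omega> > 0) \<noteq> Y \<omega>}
      \<le> best_cell_risk + (\<Sum>\<nu>\<in>F. \<bar>margin \<nu>\<bar> * exp (- (real (card J) * (margin \<nu>)\<^sup>2 / 2)))"
    unfolding risk by (intro add_left_mono sum_mono mult_left_mono) auto
qed

end

section \<open>Aggregation of classifiers built on the first data set\<close>

locale aggregation = iid_sample P X Y Xs Ys
  for P :: "'w measure" and X :: "'w \<Rightarrow> 'f::polish_space" and Y and Xs :: "nat \<Rightarrow> 'w \<Rightarrow> 'f" and Ys +
  fixes M k :: nat and g :: "nat \<Rightarrow> (nat \<Rightarrow> 'f \<times> nat) \<Rightarrow> 'f \<Rightarrow> nat"
  assumes measurable_g: "\<And>m. m \<in> {1..M} \<Longrightarrow>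
      (\<lambda>(d, x). g m d x) \<in> sample_space k \<Otimes>\<^sub>M borel \<rightarrow>\<^sub>M count_space {0, 1}"
begin

abbreviation cells :: "(nat \<Rightarrow> nat) set" where
  "cells \<equiv> {1..M} \<rightarrow>\<^sub>E {0, 1}"

abbreviation cell_margin :: "(nat \<Rightarrow> 'f \<times> nat) \<Rightarrow> (nat \<Rightarrow> nat) \<Rightarrow> real" where
  "cell_margin d \<equiv> partitioned_sample.margin P X Y (classifier_vec M g d)"

abbreviation limit_risk :: "(nat \<Rightarrow> 'f \<times> nat) \<Rightarrow> real" where
  "limit_risk d \<equiv> partitioned_sample.best_cell_risk P X Y (classifier_vec M g d) cells"

abbreviation agg_error :: "nat \<Rightarrow> (nat \<Rightarrow> 'f \<times> nat) \<Rightarrow> 'w \<Rightarrow> bool" where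
  "agg_error l d \<omega> \<equiv>
     agg_classifier (classifier_vec M g d) (\<lambda>i. Xs i \<omega>) (\<lambda>i. Ys i \<omega>) k l (X \<omega>) \<noteq> Y \<omega>"

lemma finite_cells: "finite cells"
  by (intro finite_PiE) auto

lemma classifier_vec_eq_iff:
  "classifier_vec M g d x = classifier_vec M g d x' \<longleftrightarrow> (\<forall>m\<in>{1..M}. g m d x = g m d x')"
  by (auto simp: classifier_vec_def fun_eq_iff restrict_def)

lemma classifier_vec_eq_cell_iff:
  "\<nu> \<in> cells \<Longrightarrow> classifier_vec M g d x = \<nu> \<longleftrightarrow> (\<forall>m\<in>{1..M}. g m d x = \<nu> m)"
  by (auto simp: classifier_vec_def fun_eq_iff restrict_def PiE_iff extensional_def)

lemma measurable_classifier:
  assumes "d \<in> space (sample_space k)" "m \<in> {1..M}"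
  shows "g m d \<in> borel \<rightarrow>\<^sub>M count_space {0, 1}"
  using measurable_compose[OF measurable_Pair1'[OF assms(1)] measurable_g[OF assms(2)]] by simp

text \<open>This carries the results on a fixed partition over to every possible value \<open>d\<close> of the data set.\<close>

lemma partitioned_sample_at:
  assumes d: "d \<in> space (sample_space k)"
  shows "partitioned_sample P X Y Xs Ys (classifier_vec M g d) cells"
proof unfold_locales
  show "finite cells" by (rule finite_cells)
  show "classifier_vec M g d x \<in> cells" for x
    using measurable_space[OF measurable_classifier[OF d], of _ x] by (auto simp: classifier_vec_def)
  fix \<nu> assume \<nu>: "\<nu> \<in> cells"
  have "{x \<in> space borel. \<forall>m\<in>{1..M}. g m d x = \<nu> m} \<in> sets borel"
  proof (intro sets.sets_Collect_finite_All)
    fix m assume m: "m \<in> {1..M}"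
    have "g m d -` {\<nu> m} \<inter> space borel \<in> sets borel"
      using \<nu> m by (intro measurable_sets[OF measurable_classifier[OF d m]]) auto
    then show "{x \<in> space borel. g m d x = \<nu> m} \<in> sets borel"
      by (simp add: vimage_def)
  qed auto
  then show "{x. classifier_vec M g d x = \<nu>} \<in> sets borel"
    using \<nu> by (simp add: classifier_vec_eq_cell_iff)
qed

text \<open>The cells determine the value of each classifier, so a classifier is one of the rules constant on cells.\<close>

lemma limit_risk_le_classifier:
  assumes d: "d \<in> space (sample_space k)" and m: "m \<in> {1..M}"
  shows "limit_risk d \<le> prob {\<omega> \<in> space P. g m d (X \<omega>) \<noteq> Y \<omega>}"
proof -
  interpret part: partitioned_sample P X Y Xs Ys "classifier_vec M g d" cells
    by (rule partitioned_sample_at) fact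
  have "g m d x = of_bool (classifier_vec M g d x m = 1)" for x
    using measurable_space[OF measurable_classifier[OF d m], of x] m by (auto simp: classifier_vec_def)
  then show ?thesis
    using part.best_cell_risk_le[of "\<lambda>\<nu>. \<nu> m = 1"] by simp
qed

lemma agg_error_bounds:
  assumes d: "d \<in> space (sample_space k)" and l: "l \<ge> 1"
  shows "limit_risk d \<le> prob {\<omega> \<in> space P. agg_error l d \<omega>}"
    and "prob {\<omega> \<in> space P. agg_error l d \<omega>}
      \<le> limit_risk d + (\<Sum>\<nu>\<in>cells. \<bar>cell_margin d \<nu>\<bar> * exp (- (real l * (cell_margin d \<nu>)\<^sup>2 / 2)))"
proof -
  interpret part: partitioned_sample P X Y Xs Ys "classifier_vec M g d" cells
    by (rule partitioned_sample_at) fact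
  have "agg_classifier (classifier_vec M g d) (\<lambda>i. Xs i \<omega>) (\<lambda>i. Ys i \<omega>) k l (X \<omega>)
      = of_bool (part.vote {k+1..k+l} (classifier_vec M g d (X \<omega>)) \<omega> > 0)" for \<omega>
    unfolding agg_classifier_eq_margin_vote part.vote_def part.ballot_def by simp
  then show "limit_risk d \<le> prob {\<omega> \<in> space P. agg_error l d \<omega>}"
    and "prob {\<omega> \<in> space P. agg_error l d \<omega>}
      \<le> limit_risk d + (\<Sum>\<nu>\<in>cells. \<bar>cell_margin d \<nu>\<bar> * exp (- (real l * (cell_margin d \<nu>)\<^sup>2 / 2)))"
    using part.vote_risk_bounds[of "{k+1..k+l}"] l by auto
qed

lemma cell_margin_eq:
  assumes d: "d \<in> space (sample_space k)" and \<nu>: "\<nu> \<in> cells"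
  shows "cell_margin d \<nu> = prob {\<omega> \<in> space P. (X \<omega>, Y \<omega>) \<in> cell M g d \<nu> 1}
                        - prob {\<omega> \<in> space P. (X \<omega>, Y \<omega>) \<in> cell M g d \<nu> 0}"
proof -
  interpret part: partitioned_sample P X Y Xs Ys "classifier_vec M g d" cells
    by (rule partitioned_sample_at) fact
  have "(x, y) \<in> cell M g d \<nu> y' \<longleftrightarrow> classifier_vec M g d x = \<nu> \<and> y = y'" for x y y'
    using \<nu> by (auto simp: cell_def classifier_vec_eq_cell_iff)
  then show ?thesis
    by (simp add: part.margin_def part.cell_prob_def)
qed

text \<open>The conditional risks are written as probabilities with frozen data; what has to be checked is that
each error event is jointly measurable in the data set and the remaining observations.\<close>

context
  fixes l :: nat
begin

abbreviation joint_space where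
  "joint_space \<equiv> sample_space k \<Otimes>\<^sub>M (\<Pi>\<^sub>M i\<in>insert 0 {k+1..k+l}. obs_space)"

lemma measurable_joint_obs:
  "i \<in> insert 0 {k+1..k+l} \<Longrightarrow> (\<lambda>p. snd p i) \<in> joint_space \<rightarrow>\<^sub>M obs_space"
  by (rule measurable_compose[OF measurable_snd measurable_component_singleton])

lemma measurable_joint_point:
  "i \<in> insert 0 {k+1..k+l} \<Longrightarrow> (\<lambda>p. fst (snd p i)) \<in> joint_space \<rightarrow>\<^sub>M borel"
  by (rule measurable_compose[OF measurable_joint_obs measurable_point])

lemma measurable_joint_label:
  "i \<in> insert 0 {k+1..k+l} \<Longrightarrow> (\<lambda>p. snd (snd p i)) \<in> joint_space \<rightarrow>\<^sub>M count_space UNIV"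
  by (rule measurable_compose[OF measurable_joint_obs measurable_label])

lemma measurable_joint_classifier:
  assumes "i \<in> insert 0 {k+1..k+l}" "m \<in> {1..M}"
  shows "(\<lambda>p. g m (fst p) (fst (snd p i))) \<in> joint_space \<rightarrow>\<^sub>M count_space UNIV"
proof -
  have "(\<lambda>p. (\<lambda>(d, x). g m d x) (fst p, fst (snd p i))) \<in> joint_space \<rightarrow>\<^sub>M count_space {0, 1}"
    by (intro measurable_compose[OF _ measurable_g] measurable_Pair measurable_fst
        measurable_joint_point assms)
  from measurable_compose[OF this, of "\<lambda>y. y" "count_space UNIV"] show ?thesis
    by simp
qed

lemma cond_classifier_risk:
  assumes "l \<ge> 1" "m \<in> {1..M}"
  shows "AE \<omega> in P. classifier_risk P X Y Xs Ys k g m \<omega>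
           = prob {\<omega>' \<in> space P. g m (sample Xs Ys k \<omega>) (X \<omega>') \<noteq> Y \<omega>'}"
  unfolding classifier_risk_def
proof (rule cond_prob_given_sample[where Q = "\<lambda>d \<omega>. g m d (X \<omega>) \<noteq> Y \<omega>"
      and R = "\<lambda>d z. g m d (fst (z 0)) \<noteq> snd (z 0)", OF assms(1)])
  note [measurable] = pred_eq_count_space[OF measurable_joint_classifier[OF insertI1 assms(2)]
      measurable_joint_label[OF insertI1]]
  show "{p \<in> space joint_space. g m (fst p) (fst (snd p 0)) \<noteq> snd (snd p 0)} \<in> sets joint_space"
    by measurable
qed (simp add: obs_def)

lemma cond_cell_prob:
  assumes "l \<ge> 1" "\<nu> \<in> cells"
  shows "AE \<omega> in P. cond_prob_given P (sample_space k) (sample Xs Ys k)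
             (\<lambda>\<omega>'. (X \<omega>', Y \<omega>') \<in> cell M g (sample Xs Ys k \<omega>') \<nu> y) \<omega>
           = prob {\<omega>' \<in> space P. (X \<omega>', Y \<omega>') \<in> cell M g (sample Xs Ys k \<omega>) \<nu> y}"
proof (rule cond_prob_given_sample[where Q = "\<lambda>d \<omega>. (X \<omega>, Y \<omega>) \<in> cell M g d \<nu> y"
      and R = "\<lambda>d z. (\<forall>m\<in>{1..M}. g m d (fst (z 0)) = \<nu> m) \<and> snd (z 0) = y", OF assms(1)])
  note [measurable] = measurable_joint_classifier[OF insertI1] measurable_joint_label[OF insertI1]
  show "{p \<in> space joint_space. (\<forall>m\<in>{1..M}. g m (fst p) (fst (snd p 0)) = \<nu> m) \<and> snd (snd p 0) = y}
      \<in> sets joint_space"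
    by measurable
qed (auto simp add: obs_def cell_def)

lemma cond_agg_risk:
  assumes "l \<ge> 1"
  shows "AE \<omega> in P. agg_risk P X Y Xs Ys k g M l \<omega>
           = prob {\<omega>' \<in> space P. agg_error l (sample Xs Ys k \<omega>) \<omega>'}"
  unfolding agg_risk_def
proof (rule cond_prob_given_sample[where Q = "\<lambda>d \<omega>. agg_error l d \<omega>"
      and R = "\<lambda>d z. agg_classifier (classifier_vec M g d) (\<lambda>i. fst (z i)) (\<lambda>i. snd (z i)) k l (fst (z 0)) \<noteq> snd (z 0)",
      OF assms])
  note [measurable] = measurable_joint_classifier measurable_joint_label
  have eq: "Measurable.pred joint_space (\<lambda>p. classifier_vec M g (fst p) (fst (snd p j))
      = classifier_vec M g (fst p) (fst (snd p 0)))" if "j \<in> {k+1..k+l}" for j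
  proof -
    have j: "j \<in> insert 0 {k+1..k+l}" using that by simp
    show ?thesis
      unfolding classifier_vec_eq_iff
      by (intro pred_intros_finite pred_eq_count_space measurable_joint_classifier insertI1 j) auto
  qed
  have "(\<lambda>p. \<Sum>j=k+1..k+l. of_bool (classifier_vec M g (fst p) (fst (snd p j))
      = classifier_vec M g (fst p) (fst (snd p 0))) * (2 * real (snd (snd p j)) - 1)) \<in> borel_measurable joint_space"
  proof (rule borel_measurable_sum)
    fix j assume j: "j \<in> {k+1..k+l}"
    then have [measurable]: "j \<in> insert 0 {k+1..k+l}" by simp
    note [measurable] = eq[OF j]
    show "(\<lambda>p. of_bool (classifier_vec M g (fst p) (fst (snd p j))
      = classifier_vec M g (fst p) (fst (snd p 0))) * (2 * real (snd (snd p j)) - 1)) \<in> borel_measurable joint_space"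
      by measurable
  qed
  note [measurable] = this
  have "(\<lambda>p. of_bool ((\<Sum>j=k+1..k+l. of_bool (classifier_vec M g (fst p) (fst (snd p j))
      = classifier_vec M g (fst p) (fst (snd p 0))) * (2 * real (snd (snd p j)) - 1)) > 0))
      \<in> joint_space \<rightarrow>\<^sub>M count_space UNIV"
    by measurable
  note [measurable] = pred_eq_count_space[OF this measurable_joint_label[OF insertI1]]
  show "{p \<in> space joint_space. agg_classifier (classifier_vec M g (fst p)) (\<lambda>i. fst (snd p i))
      (\<lambda>i. snd (snd p i)) k l (fst (snd p 0)) \<noteq> snd (snd p 0)} \<in> sets joint_space"
    unfolding agg_classifier_eq_margin_vote by measurable
next
  fix d \<omega>
  let ?z = "\<lambda>i\<in>insert 0 {k+1..k+l}. obs i \<omega>"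
  have "agg_classifier (classifier_vec M g d) (\<lambda>i. fst (?z i)) (\<lambda>i. snd (?z i)) k l (X \<omega>)
      = agg_classifier (classifier_vec M g d) (\<lambda>i. Xs i \<omega>) (\<lambda>i. Ys i \<omega>) k l (X \<omega>)"
    unfolding agg_classifier_eq_margin_vote
    by (intro arg_cong[where f = "\<lambda>s. of_bool (s > 0)"] sum.cong) (auto simp: obs_def)
  then show "agg_error l d \<omega> \<longleftrightarrow>
      agg_classifier (classifier_vec M g d) (\<lambda>i. fst (?z i)) (\<lambda>i. snd (?z i)) k l (fst (?z 0)) \<noteq> snd (?z 0)"
    by (simp add: obs_def)
qed

end

text \<open>Countably many almost sure identities are collected on one event, on which all the remaining
arguments are about a fixed data set.\<close>

lemma AE_conditional_risks:
  "AE \<omega> in P. sample Xs Ys k \<omega> \<in> space (sample_space k)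
     \<and> (\<forall>l\<ge>1. agg_risk P X Y Xs Ys k g M l \<omega> = prob {\<omega>' \<in> space P. agg_error l (sample Xs Ys k \<omega>) \<omega>'})
     \<and> (\<forall>m\<in>{1..M}. classifier_risk P X Y Xs Ys k g m \<omega>
           = prob {\<omega>' \<in> space P. g m (sample Xs Ys k \<omega>) (X \<omega>') \<noteq> Y \<omega>'})"
proof (intro AE_conjI)
  show "AE \<omega> in P. sample Xs Ys k \<omega> \<in> space (sample_space k)"
    by (intro AE_I2 measurable_space[OF measurable_sample])
  show "AE \<omega> in P. \<forall>l\<ge>1. agg_risk P X Y Xs Ys k g M l \<omega> = prob {\<omega>' \<in> space P. agg_error l (sample Xs Ys k \<omega>) \<omega>'}"
    unfolding AE_all_countable using cond_agg_risk by (auto intro: AE_impI)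
  show "AE \<omega> in P. \<forall>m\<in>{1..M}. classifier_risk P X Y Xs Ys k g m \<omega>
           = prob {\<omega>' \<in> space P. g m (sample Xs Ys k \<omega>) (X \<omega>') \<noteq> Y \<omega>'}"
    \<comment> \<open>A voting sample of any positive size yields the same identity, since only the new observation enters.\<close>
    by (intro AE_finite_allI cond_classifier_risk[of 1]) auto
qed

lemma AE_cell_margin_nonzero:
  assumes "\<forall>\<nu>\<in>cells. AE \<omega> in P.
              cond_prob_given P (sample_space k) (sample Xs Ys k)
                (\<lambda>\<omega>'. (X \<omega>', Y \<omega>') \<in> cell M g (sample Xs Ys k \<omega>') \<nu> 1) \<omega>
            - cond_prob_given P (sample_space k) (sample Xs Ys k)
                (\<lambda>\<omega>'. (X \<omega>', Y \<omega>') \<in> cell M g (sample Xs Ys k \<omega>') \<nu> 0) \<omega> \<noteq> 0"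
  shows "AE \<omega> in P. \<forall>\<nu>\<in>cells. cell_margin (sample Xs Ys k \<omega>) \<nu> \<noteq> 0"
proof (rule AE_finite_allI[OF finite_cells])
  fix \<nu> assume \<nu>: "\<nu> \<in> cells"
  show "AE \<omega> in P. cell_margin (sample Xs Ys k \<omega>) \<nu> \<noteq> 0"
    using assms[rule_format, OF \<nu>] cond_cell_prob[OF order_refl \<nu>, of 0] cond_cell_prob[OF order_refl \<nu>, of 1]
      AE_space
    by eventually_elim
      (use cell_margin_eq[OF measurable_space[OF measurable_sample] \<nu>] in simp)
qed

lemma agg_error_le_powr:
  assumes "d \<in> space (sample_space k)" "l \<ge> 1"
  shows "prob {\<omega> \<in> space P. agg_error l d \<omega>}
       \<le> limit_risk d + real (card cells) * real l powr (-1/2)"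
proof -
  have "\<bar>cell_margin d \<nu>\<bar> * exp (- (real l * (cell_margin d \<nu>)\<^sup>2 / 2)) \<le> real l powr (-1/2)" for \<nu>
    using mult_exp_neg_square_le_powr[of "\<bar>cell_margin d \<nu>\<bar>" l] assms(2) by simp
  then have "(\<Sum>\<nu>\<in>cells. \<bar>cell_margin d \<nu>\<bar> * exp (- (real l * (cell_margin d \<nu>)\<^sup>2 / 2)))
      \<le> real (card cells) * real l powr (-1/2)"
    by (intro sum_bounded_above)
  then show ?thesis
    using agg_error_bounds(2)[OF assms] by linarith
qed

lemma agg_excess_le_powr:
  assumes "d \<in> space (sample_space k)" "l \<ge> 1" "m \<in> {1..M}"
  shows "prob {\<omega> \<in> space P. agg_error l d \<omega>} - prob {\<omega> \<in> space P. g m d (X \<omega>) \<noteq> Y \<omega>}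
       \<le> real (card cells) * real l powr (-1/2)"
  using agg_error_le_powr[OF assms(1,2)] limit_risk_le_classifier[OF assms(1,3)] by linarith

text \<open>The risk given the data set actually converges, since it also cannot fall below the optimum over
rules constant on cells.\<close>

lemma agg_error_tendsto:
  assumes "d \<in> space (sample_space k)"
  shows "(\<lambda>l. prob {\<omega> \<in> space P. agg_error l d \<omega>}) \<longlonglongrightarrow> limit_risk d"
proof (rule tendsto_sandwich)
  let ?u = "\<lambda>l. limit_risk d + real (card cells) * real l powr (-1/2)"
  show "\<forall>\<^sub>F l in sequentially. limit_risk d \<le> prob {\<omega> \<in> space P. agg_error l d \<omega>}"
    using eventually_ge_at_top[of 1] by eventually_elim (rule agg_error_bounds(1)[OF assms])
  show "\<forall>\<^sub>F l in sequentially. prob {\<omega> \<in> space P. agg_error l d \<omega>} \<le> ?u l"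
    using eventually_ge_at_top[of 1] by eventually_elim (rule agg_error_le_powr[OF assms])
  have "(\<lambda>l. real l powr (-1/2)) \<longlonglongrightarrow> 0"
    by (rule tendsto_neg_powr[OF _ filterlim_real_sequentially]) simp
  then have "?u \<longlonglongrightarrow> limit_risk d + real (card cells) * 0"
    by (intro tendsto_add tendsto_mult tendsto_const)
  then show "?u \<longlonglongrightarrow> limit_risk d"
    by simp
qed simp

text \<open>With all margins nonzero the slowest cell determines the rate.  The value \<open>1\<close> on the other data sets
only ensures positivity everywhere.\<close>

definition exp_rate :: "(nat \<Rightarrow> 'f \<times> nat) \<Rightarrow> real" where
  "exp_rate d = (if \<forall>\<nu>\<in>cells. cell_margin d \<nu> \<noteq> 0 then Min ((\<lambda>\<nu>. (cell_margin d \<nu>)\<^sup>2 / 2) ` cells) else 1)"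

lemma exp_rate_pos: "exp_rate d > 0"
proof -
  have "cells \<noteq> {}" by (simp add: PiE_eq_empty_iff)
  then show ?thesis
    unfolding exp_rate_def using finite_cells by (auto simp: Min_gr_iff)
qed

lemma agg_excess_le_exp:
  assumes "d \<in> space (sample_space k)" "l \<ge> 1" "m \<in> {1..M}"
    and "\<forall>\<nu>\<in>cells. cell_margin d \<nu> \<noteq> 0"
  shows "prob {\<omega> \<in> space P. agg_error l d \<omega>} - prob {\<omega> \<in> space P. g m d (X \<omega>) \<noteq> Y \<omega>}
       \<le> (\<Sum>\<nu>\<in>cells. \<bar>cell_margin d \<nu>\<bar>) * exp (- exp_rate d * real l)"
proof -
  have "(\<Sum>\<nu>\<in>cells. \<bar>cell_margin d \<nu>\<bar> * exp (- (real l * (cell_margin d \<nu>)\<^sup>2 / 2)))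
      \<le> (\<Sum>\<nu>\<in>cells. \<bar>cell_margin d \<nu>\<bar> * exp (- exp_rate d * real l))"
  proof (intro sum_mono mult_left_mono)
    fix \<nu> assume "\<nu> \<in> cells"
    then have "exp_rate d \<le> (cell_margin d \<nu>)\<^sup>2 / 2"
      unfolding exp_rate_def if_P[OF assms(4)] using finite_cells
      by (intro Min_le finite_imageI imageI)
    then have "exp_rate d * real l \<le> (cell_margin d \<nu>)\<^sup>2 / 2 * real l"
      by (rule mult_right_mono) simp
    then show "exp (- (real l * (cell_margin d \<nu>)\<^sup>2 / 2)) \<le> exp (- exp_rate d * real l)"
      by (simp add: mult.commute)
  qed simp
  then show ?thesis
    using agg_error_bounds(2)[OF assms(1,2)] limit_risk_le_classifier[OF assms(1,3)]
    unfolding sum_distrib_right by linarith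
qed

end

section \<open>Rates and limit of the aggregated risk\<close>

theorem theorem2:
  fixes P :: "'w measure"
    and X :: "'w \<Rightarrow> 'f::polish_space" and Y :: "'w \<Rightarrow> nat"
    and Xs :: "nat \<Rightarrow> 'w \<Rightarrow> 'f" and Ys :: "nat \<Rightarrow> 'w \<Rightarrow> nat"
    and M k :: nat
    and g :: "nat \<Rightarrow> (nat \<Rightarrow> 'f \<times> nat) \<Rightarrow> 'f \<Rightarrow> nat"
  assumes P: "prob_space P"
    and XY: "(\<lambda>\<omega>. (X \<omega>, Y \<omega>)) \<in> P \<rightarrow>\<^sub>M obs_space"
    and indep: "prob_space.indep_vars P (\<lambda>_. obs_space) (\<lambda>i \<omega>. (Xs i \<omega>, Ys i \<omega>)) {1..}"
    and ident: "\<And>i. i \<ge> 1 \<Longrightarrow>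
      distr P obs_space (\<lambda>\<omega>. (Xs i \<omega>, Ys i \<omega>)) = distr P obs_space (\<lambda>\<omega>. (X \<omega>, Y \<omega>))"
    and indep_sample: "\<And>n. prob_space.indep_set P
      (sets (vimage_algebra (space P) (\<lambda>\<omega>. (X \<omega>, Y \<omega>)) obs_space))
      (sets (vimage_algebra (space P) (sample Xs Ys n) (sample_space n)))"
    and M: "M \<ge> 1"
    and g: "\<And>m. m \<in> {1..M} \<Longrightarrow>
      (\<lambda>(d, x). g m d x) \<in> sample_space k \<Otimes>\<^sub>M borel \<rightarrow>\<^sub>M count_space {0, 1}"
  shows "(\<forall>m\<in>{1..M}. bounded_by_O P (sample Xs Ys k)
            (\<lambda>l \<omega>. agg_risk P X Y Xs Ys k g M l \<omega> - classifier_risk P X Y Xs Ys k g m \<omega>)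
            (\<lambda>l _. real l powr (-1/2)))
       \<and> (AE \<omega> in P. convergent (\<lambda>l. agg_risk P X Y Xs Ys k g M l \<omega>)
            \<and> lim (\<lambda>l. agg_risk P X Y Xs Ys k g M l \<omega>)
                \<le> Min ((\<lambda>m. classifier_risk P X Y Xs Ys k g m \<omega>) ` {1..M}))
       \<and> ((\<forall>\<nu>\<in>{1..M} \<rightarrow>\<^sub>E {0, 1}. AE \<omega> in P.
              cond_prob_given P (sample_space k) (sample Xs Ys k)
                (\<lambda>\<omega>'. (X \<omega>', Y \<omega>') \<in> cell M g (sample Xs Ys k \<omega>') \<nu> 1) \<omega>
            - cond_prob_given P (sample_space k) (sample Xs Ys k)
                (\<lambda>\<omega>'. (X \<omega>', Y \<omega>') \<in> cell M g (sample Xs Ys k \<omega>') \<nu> 0) \<omega> \<noteq> 0)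
          \<longrightarrow> (\<exists>K\<^sub>1 :: (nat \<Rightarrow> 'f \<times> nat) \<Rightarrow> real. (\<forall>d. K\<^sub>1 d > 0) \<and>
                (\<forall>m\<in>{1..M}. bounded_by_O P (sample Xs Ys k)
                  (\<lambda>l \<omega>. agg_risk P X Y Xs Ys k g M l \<omega> - classifier_risk P X Y Xs Ys k g m \<omega>)
                  (\<lambda>l d. exp (- K\<^sub>1 d * real l)))))"
proof -
  interpret aggregation P X Y Xs Ys M k g
    using P XY indep ident indep_sample g
    by (intro aggregation.intro iid_sample.intro iid_sample_axioms.intro aggregation_axioms.intro) auto
  let ?D = "sample Xs Ys k"
  let ?agg = "\<lambda>l \<omega>. agg_risk P X Y Xs Ys k g M l \<omega>"
  let ?cls = "\<lambda>m \<omega>. classifier_risk P X Y Xs Ys k g m \<omega>"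
  have powr_rate: "bounded_by_O P ?D (\<lambda>l \<omega>. ?agg l \<omega> - ?cls m \<omega>) (\<lambda>l _. real l powr (-1/2))"
    if m: "m \<in> {1..M}" for m
    unfolding bounded_by_O_def
  proof (rule exI[of _ "\<lambda>_. real (card cells)"])
    show "AE \<omega> in P. \<forall>l\<ge>1. ?agg l \<omega> - ?cls m \<omega> \<le> real (card cells) * real l powr (-1/2)"
      using AE_conditional_risks by eventually_elim (use agg_excess_le_powr m in auto)
  qed
  have limit: "AE \<omega> in P. convergent (\<lambda>l. ?agg l \<omega>)
      \<and> lim (\<lambda>l. ?agg l \<omega>) \<le> Min ((\<lambda>m. ?cls m \<omega>) ` {1..M})"
    using AE_conditional_risks
  proof eventually_elim
    case (elim \<omega>)
    then have d: "?D \<omega> \<in> space (sample_space k)" by blast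
    have "\<forall>\<^sub>F l in sequentially. ?agg l \<omega> = prob {\<omega>' \<in> space P. agg_error l (?D \<omega>) \<omega>'}"
      using eventually_ge_at_top[of 1] by eventually_elim (use elim in blast)
    then have "(\<lambda>l. ?agg l \<omega>) \<longlonglongrightarrow> limit_risk (?D \<omega>)"
      using agg_error_tendsto[OF d] by (simp only: tendsto_cong)
    moreover have "limit_risk (?D \<omega>) \<le> Min ((\<lambda>m. ?cls m \<omega>) ` {1..M})"
      using elim limit_risk_le_classifier[OF d] M by (intro Min.boundedI) auto
    ultimately show ?case
      by (auto simp: convergent_def limI)
  qed
  have exp_rate: "\<exists>K\<^sub>1 :: (nat \<Rightarrow> 'f \<times> nat) \<Rightarrow> real. (\<forall>d. K\<^sub>1 d > 0) \<and>
      (\<forall>m\<in>{1..M}. bounded_by_O P ?D (\<lambda>l \<omega>. ?agg l \<omega> - ?cls m \<omega>) (\<lambda>l d. exp (- K\<^sub>1 d * real l)))"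
    if "AE \<omega> in P. \<forall>\<nu>\<in>cells. cell_margin (?D \<omega>) \<nu> \<noteq> 0"
  proof (intro exI[of _ exp_rate] conjI ballI allI exp_rate_pos)
    fix m assume m: "m \<in> {1..M}"
    show "bounded_by_O P ?D (\<lambda>l \<omega>. ?agg l \<omega> - ?cls m \<omega>) (\<lambda>l d. exp (- exp_rate d * real l))"
      unfolding bounded_by_O_def
    proof (rule exI[of _ "\<lambda>d. \<Sum>\<nu>\<in>cells. \<bar>cell_margin d \<nu>\<bar>"])
      show "AE \<omega> in P. \<forall>l\<ge>1. ?agg l \<omega> - ?cls m \<omega>
          \<le> (\<Sum>\<nu>\<in>cells. \<bar>cell_margin (?D \<omega>) \<nu>\<bar>) * exp (- exp_rate (?D \<omega>) * real l)"
        using AE_conditional_risks that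
      proof eventually_elim
        case (elim \<omega>)
        then show ?case
          using agg_excess_le_exp[of "?D \<omega>" _ m] m by simp
      qed
    qed
  qed
  show ?thesis
    using powr_rate limit exp_rate AE_cell_margin_nonzero by blast
qed

end
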